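(* Let $\psi$ be a fat-tailed waiting-time density on $\mathbb{N}=\{1,2,\dots\}$, and let $Y_t=2N(t)-t$ be the simple ADTRW whose generator process $N(t)$ has waiting-time density $\psi$. Then $\mathbb{E}[\tau_{0,n}]<\infty$ for all $n\in\mathbb{Z}$; in particular the walk is transient. Moreover the walk is biased.
   Context: A waiting-time density is a function $\psi:\mathbb{N}\to[0,1]$ with $\sum_{t\ge1}\psi(t)=1$; its generating function is $\bar\psi(u)=\sum_{t\ge1}\psi(t)u^t$, $|u|\le 1$. It is called fat-tailed if there are $\mu\in(0,1)$ and a constant $A_\mu>0$ such that $\bar\psi(u)=1-A_\mu(1-u)^\mu+o((1-u)^\mu)$ as $|1-u|\to0$ ($|u|\le1$). The generator process with waiting-time density $\psi$ is the discrete-time renewal counting process $N(t)=\max\{n\ge 0:\Delta t_1+\dots+\Delta t_n\le t\}$, $t\in\mathbb{N}_0$, where $\Delta t_1,\Delta t_2,\dots$ are i.i.d. with $\mathbb{P}(\Delta t_j=t)=\psi(t)$. The simple asymmetric discrete-time random walk (simple ADTRW) is $Y_t=2N(t)-t$ on $\mathbb{Z}$, $Y_0=0$. The expected sojourn time on site $n$ is $\mathbb{E}[\tau_{0,n}]=\sum_{t=0}^\infty\mathbb{P}(Y_t=n)\in[0,\infty]$; the walk is transient if $\mathbb{E}[\tau_{0,0}]<\infty$ and recurrent if $\mathbb{E}[\tau_{0,0}]=\infty$. Bias is understood in the large-time sense: the walk is biased if $\mathbb{E}[Y_t]/t$ does not tend to $0$ as $t\to\infty$. *)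

theory Defs
  imports "HOL-Probability.Probability" "HOL-Library.Landau_Symbols"
begin

text \<open>
  A waiting-time density lives on \<open>{1, 2, \<dots>}\<close>; it is modelled by a total function on \<open>nat\<close>
  whose value at \<open>0\<close> is never used.
\<close>

definition waiting_time_density :: "(nat \<Rightarrow> real) \<Rightarrow> bool" where
  "waiting_time_density \<psi> \<longleftrightarrow>
     (\<forall>t\<ge>1. 0 \<le> \<psi> t \<and> \<psi> t \<le> 1) \<and> (\<lambda>t. \<psi> (Suc t)) sums 1"

definition waiting_gf :: "(nat \<Rightarrow> real) \<Rightarrow> complex \<Rightarrow> complex" where
  "waiting_gf \<psi> u = (\<Sum>t. of_real (\<psi> (Suc t)) * u ^ Suc t)"

text \<open>
  The variable \<open>u\<close> ranges over the closed complex unit disc. There \<open>Re (1 - u) \<ge> 0\<close>, so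
  the principal branch of \<open>(1 - u) powr \<mu>\<close> is continuous.
\<close>

definition fat_tailed :: "(nat \<Rightarrow> real) \<Rightarrow> bool" where
  "fat_tailed \<psi> \<longleftrightarrow>
     (\<exists>\<mu> A :: real. 0 < \<mu> \<and> \<mu> < 1 \<and> 0 < A \<and>
        (\<lambda>u. waiting_gf \<psi> u - (1 - of_real A * (1 - u) powr of_real \<mu>))
          \<in> o[at 1 within cball 0 1](\<lambda>u. (1 - u) powr of_real \<mu>))"

definition iid_waiting_times ::
    "'a measure \<Rightarrow> (nat \<Rightarrow> real) \<Rightarrow> (nat \<Rightarrow> 'a \<Rightarrow> nat) \<Rightarrow> bool" where
  "iid_waiting_times M \<psi> \<Delta> \<longleftrightarrow>
     prob_space M \<and>
     prob_space.indep_vars M (\<lambda>_. count_space {1..}) \<Delta> {1..} \<and>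
     (\<forall>j\<ge>1. \<forall>t\<ge>1. measure M {\<omega> \<in> space M. \<Delta> j \<omega> = t} = \<psi> t)"

text \<open>
  For \<open>\<omega> \<in> space M\<close> all waiting times are at least \<open>1\<close>, so the set below is finite
  and contains \<open>0\<close>.
\<close>

definition generator_process :: "(nat \<Rightarrow> 'a \<Rightarrow> nat) \<Rightarrow> nat \<Rightarrow> 'a \<Rightarrow> nat" where
  "generator_process \<Delta> t \<omega> = Max {n. (\<Sum>j=1..n. \<Delta> j \<omega>) \<le> t}"

definition simple_ADTRW :: "(nat \<Rightarrow> 'a \<Rightarrow> nat) \<Rightarrow> nat \<Rightarrow> 'a \<Rightarrow> int" where
  "simple_ADTRW \<Delta> t \<omega> = 2 * int (generator_process \<Delta> t \<omega>) - int t"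

definition expected_sojourn_time :: "'a measure \<Rightarrow> (nat \<Rightarrow> 'a \<Rightarrow> int) \<Rightarrow> int \<Rightarrow> ennreal" where
  "expected_sojourn_time M Y n = (\<Sum>t. emeasure M {\<omega> \<in> space M. Y t \<omega> = n})"

definition transient_walk :: "'a measure \<Rightarrow> (nat \<Rightarrow> 'a \<Rightarrow> int) \<Rightarrow> bool" where
  "transient_walk M Y \<longleftrightarrow> expected_sojourn_time M Y 0 < \<infinity>"

definition biased_walk :: "'a measure \<Rightarrow> (nat \<Rightarrow> 'a \<Rightarrow> int) \<Rightarrow> bool" where
  "biased_walk M Y \<longleftrightarrow>
     \<not> (\<lambda>t. (\<integral>\<omega>. real_of_int (Y t \<omega>) \<partial>M) / real t) \<longlonglongrightarrow> 0"

end

theory Submission imports Defs begin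

text \<open>
  The proof is a Chernoff bound for the renewal process. Put
  \<open>S\<^sub>k = \<Delta> 1 + \<dots> + \<Delta> k\<close> and let \<open>g(s) = E[s ^ \<Delta> 1]\<close> for \<open>0 < s < 1\<close>. A fat tail makes
  \<open>1 - g(s)\<close> of order \<open>(1 - s) powr \<mu>\<close> with \<open>\<mu> < 1\<close>, so close to \<open>1\<close> the function \<open>g\<close> lies
  below every power of \<open>s\<close>; only \<open>g(s) < s ^ 4\<close> is needed
  (\<open>fat_tailed_gf_less_power\<close>). Since \<open>N(t) \<ge> k\<close> exactly when \<open>S\<^sub>k \<le> t\<close>
  (\<open>le_generator_process_iff\<close>), and independence together with Markov's inequality gives
  \<open>P(S\<^sub>k \<le> t) \<le> g(s) ^ k / s ^ t\<close> (\<open>prob_partial_sum_le\<close>), taking for \<open>k\<close> the least integer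
  with \<open>4 * k \<ge> t\<close> shows that \<open>P(4 * N(t) \<ge> t)\<close> decays geometrically in \<open>t\<close>
  (\<open>prob_generator_process_geometric\<close>).

  Both claims follow from this one estimate. If \<open>Y\<^sub>t = n\<close>, then \<open>N(t) = (t + n) / 2\<close>, which
  is at least \<open>t / 4\<close> as soon as \<open>t \<ge> 2 * \<bar>n\<bar>\<close>; so all but finitely many terms of the
  expected sojourn time are dominated by a geometric series. Off the event \<open>4 * N(t) \<ge> t\<close>
  one has \<open>Y\<^sub>t < - t / 2\<close>, so the limit superior of \<open>E[Y\<^sub>t] / t\<close> is at most \<open>- 1 / 2\<close>.
\<close>

section \<open>The generating function near one\<close>

lemma waiting_gf_summable:
  assumes "waiting_time_density \<psi>" "0 \<le> s" "s \<le> 1"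
  shows "summable (\<lambda>t. \<psi> (Suc t) * s ^ Suc t)"
proof (rule summable_comparison_test')
  show "summable (\<lambda>t. \<psi> (Suc t))"
    using assms(1) by (auto simp: waiting_time_density_def sums_iff)
  fix t :: nat
  have "0 \<le> \<psi> (Suc t)" using assms(1) by (auto simp: waiting_time_density_def)
  moreover have "s ^ Suc t \<le> 1" using assms by (intro power_le_one) auto
  ultimately have "\<psi> (Suc t) * s ^ Suc t \<le> \<psi> (Suc t)" by (rule mult_left_le[rotated])
  then show "norm (\<psi> (Suc t) * s ^ Suc t) \<le> \<psi> (Suc t)"
    using \<open>0 \<le> \<psi> (Suc t)\<close> assms by (simp add: abs_mult)
qed

lemma waiting_gf_of_real:
  assumes "waiting_time_density \<psi>" "0 \<le> s" "s \<le> 1"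
  shows "waiting_gf \<psi> (of_real s) = of_real (\<Sum>t. \<psi> (Suc t) * s ^ Suc t)"
  unfolding waiting_gf_def
  using suminf_of_real[OF waiting_gf_summable[OF assms], where 'a = complex] by simp

text \<open>
  To first order \<open>1 - s ^ m\<close> is \<open>m * (1 - s)\<close>, which is negligible against
  \<open>(1 - s) powr \<mu>\<close>; it suffices to approach \<open>1\<close> along the reals.
\<close>
lemma fat_tailed_gf_less_power:
  assumes wtd: "waiting_time_density \<psi>" and "fat_tailed \<psi>"
  shows "\<exists>s. 0 < s \<and> s < 1 \<and> (\<Sum>t. \<psi> (Suc t) * s ^ Suc t) < s ^ m"
proof -
  obtain \<mu> A :: real where \<mu>: "0 < \<mu>" "\<mu> < 1" and A: "0 < A" and
    o: "(\<lambda>u. waiting_gf \<psi> u - (1 - of_real A * (1 - u) powr of_real \<mu>))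
          \<in> o[at 1 within cball 0 1](\<lambda>u. (1 - u) powr of_real \<mu>)"
    using assms(2) unfolding fat_tailed_def by blast
  have "eventually (\<lambda>u. norm (waiting_gf \<psi> u - (1 - of_real A * (1 - u) powr of_real \<mu>))
          \<le> A / 2 * norm ((1 - u) powr of_real \<mu>)) (at 1 within cball 0 1)"
    using landau_o.smallD[OF o, of "A / 2"] A by simp
  moreover have "filterlim (of_real :: real \<Rightarrow> complex) (at 1 within cball 0 1) (at_left 1)"
    unfolding filterlim_at
  proof (intro conjI)
    have "eventually (\<lambda>s::real. 0 < s \<and> s < 1) (at_left 1)"
      using eventually_at_left_real[of 0 1] by simp
    then show "\<forall>\<^sub>F x in at_left 1. complex_of_real x \<in> cball 0 1 \<and> complex_of_real x \<noteq> 1"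
      by eventually_elim auto
    show "(complex_of_real \<longlongrightarrow> 1) (at_left 1)"
      using tendsto_of_real[OF tendsto_ident_at[of "1::real" "{..<1}"], where 'a = complex] by simp
  qed
  ultimately have ev1: "eventually (\<lambda>s. norm (waiting_gf \<psi> (of_real s)
      - (1 - of_real A * (1 - of_real s) powr of_real \<mu>))
          \<le> A / 2 * norm ((1 - complex_of_real s) powr of_real \<mu>)) (at_left 1)"
    by (rule eventually_compose_filterlim)
  have "((\<lambda>s::real. real m * (1 - s) powr (1 - \<mu>)) \<longlongrightarrow> real m * (1 - 1) powr (1 - \<mu>)) (at_left 1)"
    using \<mu> by (intro tendsto_intros tendsto_powr') (auto simp: eventually_at_filter)
  then have ev2: "eventually (\<lambda>s::real. real m * (1 - s) powr (1 - \<mu>) < A / 2) (at_left 1)"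
    using A by (intro order_tendstoD) auto
  have ev3: "eventually (\<lambda>s::real. 0 < s \<and> s < 1) (at_left 1)"
    using eventually_at_left_real[of 0 1] by simp
  have "eventually (\<lambda>s. 0 < s \<and> s < 1 \<and> (\<Sum>t. \<psi> (Suc t) * s ^ Suc t) < s ^ m) (at_left 1)"
    using ev1 ev2 ev3
  proof eventually_elim
    case (elim s)
    define g where "g = (\<Sum>t. \<psi> (Suc t) * s ^ Suc t)"
    define h where "h = (1 - s) powr \<mu>"
    have s: "0 < s" "s < 1" using elim by auto
    have gf: "waiting_gf \<psi> (of_real s) = of_real g"
      using waiting_gf_of_real[OF wtd, of s] s by (simp add: g_def)
    have pw: "(1 - complex_of_real s) powr of_real \<mu> = of_real h"
      using powr_of_real[of "1 - s" \<mu>] s by (simp add: h_def)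
    have h0: "0 < h" using s by (simp add: h_def)
    have "waiting_gf \<psi> (of_real s) - (1 - of_real A * (1 - of_real s) powr of_real \<mu>)
        = complex_of_real (g - (1 - A * h))"
      by (simp add: gf pw)
    then have "\<bar>g - (1 - A * h)\<bar> \<le> A / 2 * h"
      using elim(1) h0 pw by (metis norm_of_real abs_of_pos)
    then have "g \<le> 1 - A / 2 * h" by linarith
    also have "\<dots> < 1 - real m * (1 - s)"
    proof -
      have "real m * (1 - s) = real m * (1 - s) powr (1 - \<mu>) * h"
        using s by (simp add: h_def flip: powr_add)
      also have "\<dots> < A / 2 * h" using elim(2) h0 by (intro mult_strict_right_mono)
      finally show ?thesis by simp
    qed
    also have "\<dots> \<le> s ^ m"
      using Bernoulli_inequality[of "s - 1" m] s by (simp add: algebra_simps)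
    finally show ?case using s by (simp add: g_def)
  qed
  then show ?thesis
    using eventually_happens'[of "at_left (1::real)"] by (auto simp: trivial_limit_at_left_real)
qed

section \<open>Counting renewals along a path\<close>

lemma le_sum_of_positive:
  fixes d :: "nat \<Rightarrow> nat"
  assumes "\<And>j. 1 \<le> j \<Longrightarrow> 1 \<le> d j"
  shows "n \<le> (\<Sum>j=1..n. d j)"
  using sum_mono[of "{1..n}" "\<lambda>_. 1" d] assms by simp

lemma le_generator_process_iff:
  assumes "\<And>j. 1 \<le> j \<Longrightarrow> 1 \<le> \<Delta> j \<omega>"
  shows "k \<le> generator_process \<Delta> t \<omega> \<longleftrightarrow> (\<Sum>j=1..k. \<Delta> j \<omega>) \<le> t"
proof -
  let ?S = "\<lambda>n. \<Sum>j=1..n. \<Delta> j \<omega>"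
  let ?A = "{n. ?S n \<le> t}"
  have "n \<le> ?S n" for n using le_sum_of_positive[of "\<lambda>j. \<Delta> j \<omega>"] assms by simp
  then have "?A \<subseteq> {..t}" using order_trans[of _ "?S _" t] by blast
  then have fin: "finite ?A" by (rule finite_subset) simp
  have ne: "?A \<noteq> {}" by (auto intro: exI[of _ 0])
  have mono: "?S m \<le> ?S n" if "m \<le> n" for m n using that by (intro sum_mono2) auto
  have "Max ?A \<in> ?A" using fin ne by (rule Max_in)
  then show ?thesis
    unfolding generator_process_def
    using mono[of k "Max ?A"] Max_ge[OF fin, of k] by auto
qed

lemma generator_process_le_time:
  assumes "\<And>j. 1 \<le> j \<Longrightarrow> 1 \<le> \<Delta> j \<omega>"
  shows "generator_process \<Delta> t \<omega> \<le> t"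
proof -
  let ?N = "generator_process \<Delta> t \<omega>"
  have "(\<Sum>j=1..?N. \<Delta> j \<omega>) \<le> t" using le_generator_process_iff[of \<Delta> \<omega> ?N t] assms by simp
  then show ?thesis using le_sum_of_positive[of "\<lambda>j. \<Delta> j \<omega>" ?N] assms by simp
qed

section \<open>The Chernoff bound\<close>

lemma iid_waiting_times_measurable:
  assumes "iid_waiting_times M \<psi> \<Delta>" "1 \<le> j"
  shows "\<Delta> j \<in> measurable M (count_space {1..})"
proof -
  interpret prob_space M using assms by (simp add: iid_waiting_times_def)
  show ?thesis using assms by (auto simp: iid_waiting_times_def indep_vars_def)
qed

lemma iid_waiting_times_ge_1:
  assumes "iid_waiting_times M \<psi> \<Delta>" "1 \<le> j" "\<omega> \<in> space M"
  shows "1 \<le> \<Delta> j \<omega>"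
  using measurable_space[OF iid_waiting_times_measurable[OF assms(1,2)] assms(3)] by simp

lemma iid_waiting_times_measurable_fun:
  assumes "iid_waiting_times M \<psi> \<Delta>" "1 \<le> j"
  shows "(\<lambda>\<omega>. \<Delta> j \<omega>) \<in> measurable M (count_space UNIV)"
  using measurable_compose[OF iid_waiting_times_measurable[OF assms], of "\<lambda>x. x" "count_space UNIV"]
  by simp

lemma partial_sum_measurable:
  assumes "iid_waiting_times M \<psi> \<Delta>"
  shows "(\<lambda>\<omega>. \<Sum>j=1..k. \<Delta> j \<omega>) \<in> measurable M (count_space UNIV)"
  using iid_waiting_times_measurable_fun[OF assms]
  by (intro measurable_sum_nat) auto

lemma generator_process_measurable:
  assumes "iid_waiting_times M \<psi> \<Delta>"
  shows "generator_process \<Delta> t \<in> measurable M (count_space UNIV)"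
proof -
  have ge: "{\<omega> \<in> space M. k \<le> generator_process \<Delta> t \<omega>} \<in> sets M" for k
  proof -
    have "{\<omega> \<in> space M. k \<le> generator_process \<Delta> t \<omega>} = {\<omega> \<in> space M. (\<Sum>j=1..k. \<Delta> j \<omega>) \<le> t}"
      using le_generator_process_iff[of \<Delta> _ k t] iid_waiting_times_ge_1[OF assms] by blast
    then show ?thesis using partial_sum_measurable[OF assms, of k] by simp
  qed
  have "generator_process \<Delta> t -` {k} \<inter> space M \<in> sets M" for k
  proof -
    have "generator_process \<Delta> t -` {k} \<inter> space M = {\<omega> \<in> space M. k \<le> generator_process \<Delta> t \<omega>}
        - {\<omega> \<in> space M. Suc k \<le> generator_process \<Delta> t \<omega>}" by auto
    then show ?thesis using sets.Diff[OF ge[of k] ge[of "Suc k"]] by simp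
  qed
  then show ?thesis by (simp add: measurable_count_space_eq2_countable)
qed

lemma nn_integral_power_waiting_time:
  assumes wtd: "waiting_time_density \<psi>" and iid: "iid_waiting_times M \<psi> \<Delta>" and j: "1 \<le> j"
    and s: "0 \<le> s" "s \<le> 1"
  shows "(\<integral>\<^sup>+\<omega>. ennreal (s ^ \<Delta> j \<omega>) \<partial>M) = ennreal (\<Sum>t. \<psi> (Suc t) * s ^ Suc t)"
proof -
  interpret prob_space M using iid by (simp add: iid_waiting_times_def)
  let ?E = "\<lambda>t. {\<omega> \<in> space M. \<Delta> j \<omega> = Suc t}"
  have [measurable]: "\<Delta> j \<in> measurable M (count_space UNIV)"
    using iid_waiting_times_measurable_fun[OF iid j] by simp
  have "(\<integral>\<^sup>+\<omega>. ennreal (s ^ \<Delta> j \<omega>) \<partial>M)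
      = (\<integral>\<^sup>+\<omega>. (\<Sum>t. ennreal (s ^ Suc t) * indicator (?E t) \<omega>) \<partial>M)"
  proof (rule nn_integral_cong)
    fix \<omega> assume \<omega>: "\<omega> \<in> space M"
    have "(\<Sum>t. ennreal (s ^ Suc t) * indicator (?E t) \<omega>)
        = (\<Sum>t\<in>{\<Delta> j \<omega> - 1}. ennreal (s ^ Suc t) * indicator (?E t) \<omega>)"
      using iid_waiting_times_ge_1[OF iid j \<omega>] by (intro suminf_finite) (auto simp: indicator_def)
    then show "ennreal (s ^ \<Delta> j \<omega>) = (\<Sum>t. ennreal (s ^ Suc t) * indicator (?E t) \<omega>)"
      using iid_waiting_times_ge_1[OF iid j \<omega>] \<omega> by simp
  qed
  also have "\<dots> = (\<Sum>t. \<integral>\<^sup>+\<omega>. ennreal (s ^ Suc t) * indicator (?E t) \<omega> \<partial>M)"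
    by (intro nn_integral_suminf) measurable
  also have "\<dots> = (\<Sum>t. ennreal (\<psi> (Suc t) * s ^ Suc t))"
  proof (rule suminf_cong)
    fix t
    have "measure M (?E t) = \<psi> (Suc t)" using iid j by (simp add: iid_waiting_times_def)
    then show "(\<integral>\<^sup>+\<omega>. ennreal (s ^ Suc t) * indicator (?E t) \<omega> \<partial>M) = ennreal (\<psi> (Suc t) * s ^ Suc t)"
      using s by (simp add: nn_integral_cmult_indicator emeasure_eq_measure mult.commute
          flip: ennreal_mult''
          del: power_Suc)
  qed
  also have "\<dots> = ennreal (\<Sum>t. \<psi> (Suc t) * s ^ Suc t)"
    using wtd s waiting_gf_summable[OF wtd s]
    by (intro suminf_ennreal2) (auto simp: waiting_time_density_def)
  finally show ?thesis .
qed

text \<open>Markov's inequality for \<open>s ^ S\<^sub>k\<close>, whose expectation factorises by independence.\<close>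
lemma prob_partial_sum_le:
  assumes wtd: "waiting_time_density \<psi>" and iid: "iid_waiting_times M \<psi> \<Delta>"
    and s: "0 < s" "s \<le> 1"
  shows "emeasure M {\<omega> \<in> space M. (\<Sum>j=1..k. \<Delta> j \<omega>) \<le> t}
       \<le> ennreal ((\<Sum>t. \<psi> (Suc t) * s ^ Suc t) ^ k / s ^ t)"
proof -
  interpret prob_space M using iid by (simp add: iid_waiting_times_def)
  let ?g = "\<Sum>t. \<psi> (Suc t) * s ^ Suc t"
  let ?S = "\<lambda>\<omega>. \<Sum>j=1..k. \<Delta> j \<omega>"
  have g0: "0 \<le> ?g" using wtd s by (intro suminf_nonneg waiting_gf_summable) (auto simp: waiting_time_density_def)
  have [measurable]: "?S \<in> measurable M (count_space UNIV)"
    using partial_sum_measurable[OF iid] .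
  have ind: "indep_vars (\<lambda>_. borel) (\<lambda>j \<omega>. ennreal (s ^ \<Delta> j \<omega>)) {1..k}"
  proof (rule indep_vars_compose2[where M' = "\<lambda>_. count_space {1..}" and X = \<Delta>])
    have "indep_vars (\<lambda>_. count_space {1..}) \<Delta> {1..}"
      using iid by (simp add: iid_waiting_times_def)
    then show "indep_vars (\<lambda>_. count_space {1..}) \<Delta> {1..k}"
      by (rule indep_vars_subset) auto
  qed simp
  have "emeasure M {\<omega> \<in> space M. ?S \<omega> \<le> t}
      = (\<integral>\<^sup>+\<omega>. indicator {\<omega> \<in> space M. ?S \<omega> \<le> t} \<omega> \<partial>M)"
    by (rule nn_integral_indicator[symmetric]) measurable
  also have "\<dots> \<le> (\<integral>\<^sup>+\<omega>. ennreal (1 / s ^ t) * ennreal (s ^ ?S \<omega>) \<partial>M)"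
  proof (rule nn_integral_mono)
    fix \<omega>
    have "1 \<le> 1 / s ^ t * s ^ ?S \<omega>" if "?S \<omega> \<le> t"
      using power_decreasing[OF that, of s] s by (simp add: field_simps)
    then show "indicator {\<omega> \<in> space M. ?S \<omega> \<le> t} \<omega> \<le> ennreal (1 / s ^ t) * ennreal (s ^ ?S \<omega>)"
      using s by (auto simp: indicator_def simp flip: ennreal_mult)
  qed
  also have "\<dots> = ennreal (1 / s ^ t) * (\<integral>\<^sup>+\<omega>. ennreal (s ^ ?S \<omega>) \<partial>M)"
    by (intro nn_integral_cmult) measurable
  also have "(\<integral>\<^sup>+\<omega>. ennreal (s ^ ?S \<omega>) \<partial>M) = (\<integral>\<^sup>+\<omega>. (\<Prod>j=1..k. ennreal (s ^ \<Delta> j \<omega>)) \<partial>M)"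
    using s by (simp add: power_sum prod_ennreal)
  also have "\<dots> = (\<Prod>j=1..k. \<integral>\<^sup>+\<omega>. ennreal (s ^ \<Delta> j \<omega>) \<partial>M)"
    by (rule indep_vars_nn_integral[OF _ ind]) auto
  also have "\<dots> = (\<Prod>j=1..k. ennreal ?g)"
    using nn_integral_power_waiting_time[OF wtd iid] s by (intro prod.cong) auto
  also have "\<dots> = ennreal (?g ^ k)" using g0 by (simp add: ennreal_power)
  finally show ?thesis using s g0 by (simp flip: ennreal_mult)
qed

text \<open>
  With \<open>q\<close> the fourth root of \<open>g(s)\<close> one has \<open>q < s\<close>, and \<open>4 * k \<ge> t\<close> turns
  \<open>g(s) ^ k / s ^ t\<close> into at most \<open>(q / s) ^ t\<close>.
\<close>
lemma prob_generator_process_geometric: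
  assumes wtd: "waiting_time_density \<psi>" and fat: "fat_tailed \<psi>"
    and iid: "iid_waiting_times M \<psi> \<Delta>"
  shows "\<exists>r::real. 0 \<le> r \<and> r < 1 \<and>
    (\<forall>t. emeasure M {\<omega> \<in> space M. t \<le> 4 * generator_process \<Delta> t \<omega>} \<le> ennreal (r ^ t))"
proof -
  obtain s where s: "0 < s" "s < 1" and less: "(\<Sum>t. \<psi> (Suc t) * s ^ Suc t) < s ^ 4"
    using fat_tailed_gf_less_power[OF wtd fat] by blast
  define g where "g = (\<Sum>t. \<psi> (Suc t) * s ^ Suc t)"
  have g0: "0 \<le> g"
    unfolding g_def using wtd s
    by (intro suminf_nonneg waiting_gf_summable) (auto simp: waiting_time_density_def)
  define q where "q = root 4 g"
  have q: "0 \<le> q" "q ^ 4 = g" using g0 by (auto simp: q_def)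
  have "q ^ 4 < s ^ 4" using less q by (simp add: g_def)
  then have qs: "q < s" using s by (intro power_less_imp_less_base[of q 4 s]) auto
  have "emeasure M {\<omega> \<in> space M. t \<le> 4 * generator_process \<Delta> t \<omega>} \<le> ennreal ((q / s) ^ t)" for t
  proof -
    \<comment> \<open>The ceiling of \<open>t / 4\<close>.\<close>
    define k where "k = (t + 3) div 4"
    have k: "t \<le> 4 * n \<longleftrightarrow> k \<le> n" for n unfolding k_def by linarith
    have "{\<omega> \<in> space M. t \<le> 4 * generator_process \<Delta> t \<omega>}
        = {\<omega> \<in> space M. (\<Sum>j=1..k. \<Delta> j \<omega>) \<le> t}"
      using le_generator_process_iff[of \<Delta> _ k t] iid_waiting_times_ge_1[OF iid] k by blast
    also have "emeasure M \<dots> \<le> ennreal (g ^ k / s ^ t)"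
      using prob_partial_sum_le[OF wtd iid, of s k t] s by (simp add: g_def)
    also have "g ^ k / s ^ t \<le> (q / s) ^ t"
    proof -
      have "g ^ k = q ^ (4 * k)" using q by (simp add: power_mult)
      also have "\<dots> \<le> q ^ t" using q qs s k[of k] by (intro power_decreasing) auto
      finally show ?thesis using s by (simp add: power_divide divide_right_mono)
    qed
    finally show ?thesis by (simp add: ennreal_leI)
  qed
  moreover have "0 \<le> q / s" "q / s < 1" using q qs s by auto
  ultimately show ?thesis by blast
qed

section \<open>Transience and bias\<close>

lemma expected_sojourn_time_finite:
  assumes iid: "iid_waiting_times M \<psi> \<Delta>" and r: "0 \<le> r" "r < 1"
    and bound: "\<And>t. emeasure M {\<omega> \<in> space M. t \<le> 4 * generator_process \<Delta> t \<omega>} \<le> ennreal (r ^ t)"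
  shows "expected_sojourn_time M (simple_ADTRW \<Delta>) n < \<infinity>"
proof -
  interpret prob_space M using iid by (simp add: iid_waiting_times_def)
  let ?f = "\<lambda>t. emeasure M {\<omega> \<in> space M. simple_ADTRW \<Delta> t \<omega> = n}"
  define m where "m = nat (2 * \<bar>n\<bar>)"
  have "?f (t + m) \<le> ennreal (r ^ (t + m))" for t
  proof -
    have "?f (t + m) \<le> emeasure M {\<omega> \<in> space M. t + m \<le> 4 * generator_process \<Delta> (t + m) \<omega>}"
      using generator_process_measurable[OF iid]
      by (intro emeasure_mono) (auto simp: simple_ADTRW_def m_def)
    then show ?thesis using bound order_trans by blast
  qed
  then have "(\<Sum>t. ?f (t + m)) \<le> (\<Sum>t. ennreal (r ^ (t + m)))"
    by (intro suminf_le) auto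
  also have "\<dots> = ennreal (\<Sum>t. r ^ (t + m))"
    using r by (intro suminf_ennreal2 summable_ignore_initial_segment summable_geometric) auto
  finally have tail: "(\<Sum>t. ?f (t + m)) < \<infinity>"
    by (simp add: le_less_trans)
  have "(\<Sum>t. ?f t) = (\<Sum>t. ?f (t + m)) + (\<Sum>t<m. ?f t)"
    by (intro suminf_offset) auto
  moreover have "(\<Sum>t<m. ?f t) < \<infinity>" by (simp add: sum_Pinfty less_top[symmetric])
  ultimately show ?thesis using tail by (simp add: expected_sojourn_time_def less_top)
qed

text \<open>
  Pathwise \<open>Y\<^sub>t \<le> - t / 2 + 2 * t * 1[4 * N(t) \<ge> t]\<close>: on the event this weakens \<open>Y\<^sub>t \<le> t\<close>.
\<close>
lemma simple_ADTRW_biased: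
  assumes iid: "iid_waiting_times M \<psi> \<Delta>" and r: "0 \<le> r" "r < 1"
    and bound: "\<And>t. emeasure M {\<omega> \<in> space M. t \<le> 4 * generator_process \<Delta> t \<omega>} \<le> ennreal (r ^ t)"
  shows "biased_walk M (simple_ADTRW \<Delta>)"
  unfolding biased_walk_def
proof
  interpret prob_space M using iid by (simp add: iid_waiting_times_def)
  let ?Y = "\<lambda>t \<omega>. real_of_int (simple_ADTRW \<Delta> t \<omega>)"
  assume lim: "(\<lambda>t. (\<integral>\<omega>. ?Y t \<omega> \<partial>M) / real t) \<longlonglongrightarrow> 0"
  have le: "(\<integral>\<omega>. ?Y t \<omega> \<partial>M) / real t \<le> - 1 / 2 + 2 * r ^ t" if "t > 0" for t
  proof -
    let ?E = "{\<omega> \<in> space M. t \<le> 4 * generator_process \<Delta> t \<omega>}"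
    have [measurable]: "generator_process \<Delta> t \<in> measurable M (count_space UNIV)"
      using generator_process_measurable[OF iid] .
    have E: "?E \<in> sets M" by measurable
    have N_le: "generator_process \<Delta> t \<omega> \<le> t" if "\<omega> \<in> space M" for \<omega>
      using iid_waiting_times_ge_1[OF iid _ that] by (intro generator_process_le_time[of \<Delta> \<omega> t]) simp
    have Ymeas: "?Y t \<in> borel_measurable M" unfolding simple_ADTRW_def by measurable
    have "integrable M (?Y t)"
    proof (rule integrable_const_bound[OF _ Ymeas, of "real t"])
      show "AE \<omega> in M. norm (?Y t \<omega>) \<le> real t"
        using N_le by (intro AE_I2) (force simp: simple_ADTRW_def abs_le_iff)
    qed
    moreover have "integrable M (\<lambda>\<omega>. - real t / 2 + 2 * real t * indicator ?E \<omega>)"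
      using E by (auto simp: emeasure_eq_measure)
    moreover have "?Y t \<omega> \<le> - real t / 2 + 2 * real t * indicator ?E \<omega>" if "\<omega> \<in> space M" for \<omega>
      using N_le[OF that] that by (auto simp: simple_ADTRW_def indicator_def)
    ultimately have "(\<integral>\<omega>. ?Y t \<omega> \<partial>M) \<le> (\<integral>\<omega>. - real t / 2 + 2 * real t * indicator ?E \<omega> \<partial>M)"
      by (intro integral_mono)
    also have "\<dots> = - real t / 2 + 2 * real t * measure M ?E"
      using E by (subst Bochner_Integration.integral_add)
        (auto simp: emeasure_eq_measure prob_space)
    also have "\<dots> \<le> - real t / 2 + 2 * real t * r ^ t"
    proof -
      have "measure M ?E \<le> r ^ t" using bound[of t] r by (simp add: emeasure_eq_measure)
      then show ?thesis by (simp add: mult_left_mono)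
    qed
    finally show ?thesis using that by (simp add: field_simps)
  qed
  have "(\<lambda>t. - 1 / 2 + 2 * r ^ t) \<longlonglongrightarrow> - 1 / 2 + 2 * 0"
    using r by (intro tendsto_intros LIMSEQ_power_zero) auto
  then have "(0::real) \<le> - 1 / 2 + 2 * 0"
    using lim le by (intro LIMSEQ_le[OF lim]) (auto intro: exI[of _ 1])
  then show False by simp
qed

theorem mainTheorem2:
  fixes M :: "'a measure" and \<psi> :: "nat \<Rightarrow> real" and \<Delta> :: "nat \<Rightarrow> 'a \<Rightarrow> nat"
  assumes "waiting_time_density \<psi>" and "fat_tailed \<psi>"
    and "iid_waiting_times M \<psi> \<Delta>"
  shows "(\<forall>n::int. expected_sojourn_time M (simple_ADTRW \<Delta>) n < \<infinity>) \<and>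
         transient_walk M (simple_ADTRW \<Delta>) \<and>
         biased_walk M (simple_ADTRW \<Delta>)"
  using prob_generator_process_geometric[OF assms]
    expected_sojourn_time_finite[OF assms(3)] simple_ADTRW_biased[OF assms(3)]
  unfolding transient_walk_def by blast

end
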